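(* Let $M$ be a matroid of rank $k$ on a ground set $E$ of size $n$, and let $r\in[n-k]$. Then (a) $d_r(M)=\min\{|J| : J\subseteq E \text{ and } x^J\in I^{(r)}_{\Delta(M)}\}$ (i.e., the smallest degree of a squarefree monomial in $I^{(r)}_{\Delta(M)}$); (b) $d_r(M)=\min\{|U| : U\subseteq E \text{ and } |U|-\mathrm{rk}_M(U)\ge r\}$; (c) $d_r(M)=n-\max\{|F| : F \text{ is a flat of } M^* \text{ of rank } n-k-r\}$.
   Context: $[m]=\{1,\dots,m\}$. $M^*$ is the dual matroid of $M$ and $\mathcal{B}(M^* )$ its set of bases. For $r\in[n-k]$ the $r$-th generalized Hamming weight of $M$ is $d_r(M)=\min\{|U| : U\subseteq E,\ |U|-\mathrm{rk}_M(U)=r\}$. Let $S=\mathbb{L}[x_e: e\in E]$ be a polynomial ring over a field $\mathbb{L}$; for $U\subseteq E$ put $x^U=\prod_{u\in U}x_u$ and $P_U=\langle x_u: u\in U\rangle$. $\Delta(M)$ is the independence complex of $M$ and $I_{\Delta(M)}=\langle x^C: C \text{ a circuit of } M\rangle=\bigcap_{B\in\mathcal{B}(M^* )}P_B$ is its Stanley-Reisner ideal, with $s$-th symbolic power $I_{\Delta(M)}^{(s)}=\bigcap_{B\in\mathcal{B}(M^* )}P_B^s$. *)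

theory Defs
  imports "HOL-Library.Poly_Mapping" "HOL-Algebra.Ideal_Product"
begin

section \<open>Matroids\<close>

locale matroid =
  fixes E :: "'a set" and indep :: "'a set \<Rightarrow> bool"
  assumes finite_ground: "finite E"
    and indep_subset: "indep X \<Longrightarrow> X \<subseteq> E"
    and indep_empty: "indep {}"
    and indep_mono: "indep X \<Longrightarrow> Y \<subseteq> X \<Longrightarrow> indep Y"
    and indep_augment: "indep X \<Longrightarrow> indep Y \<Longrightarrow> card X < card Y \<Longrightarrow>
      \<exists>y\<in>Y - X. indep (insert y X)"

definition basis :: "('a set \<Rightarrow> bool) \<Rightarrow> 'a set \<Rightarrow> bool" where
  "basis indep B \<longleftrightarrow> indep B \<and> (\<forall>X. indep X \<and> B \<subseteq> X \<longrightarrow> X = B)"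

definition circuit :: "'a set \<Rightarrow> ('a set \<Rightarrow> bool) \<Rightarrow> 'a set \<Rightarrow> bool" where
  "circuit E indep C \<longleftrightarrow> C \<subseteq> E \<and> \<not> indep C \<and> (\<forall>X. X \<subset> C \<longrightarrow> indep X)"

definition rk :: "('a set \<Rightarrow> bool) \<Rightarrow> 'a set \<Rightarrow> nat" where
  "rk indep U = Max {card X | X. X \<subseteq> U \<and> indep X}"

definition flat :: "'a set \<Rightarrow> ('a set \<Rightarrow> bool) \<Rightarrow> 'a set \<Rightarrow> bool" where
  "flat E indep F \<longleftrightarrow> F \<subseteq> E \<and> (\<forall>e\<in>E - F. rk indep F < rk indep (insert e F))"

definition dual_indep :: "'a set \<Rightarrow> ('a set \<Rightarrow> bool) \<Rightarrow> 'a set \<Rightarrow> bool" where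
  "dual_indep E indep X \<longleftrightarrow> X \<subseteq> E \<and> (\<exists>B. basis indep B \<and> X \<inter> B = {})"

definition gen_hamming_weight :: "'a set \<Rightarrow> ('a set \<Rightarrow> bool) \<Rightarrow> nat \<Rightarrow> nat" where
  "gen_hamming_weight E indep r = Min {card U | U. U \<subseteq> E \<and> card U - rk indep U = r}"

lemma (in matroid) basis_subset: "basis indep B \<Longrightarrow> B \<subseteq> E"
  using indep_subset by (auto simp: basis_def)

lemma (in matroid) basis_dual_iff:
  "basis (dual_indep E indep) B \<longleftrightarrow> B \<subseteq> E \<and> basis indep (E - B)"
proof
  assume B: "basis (dual_indep E indep) B"
  then obtain B0 where B0: "B \<subseteq> E" "basis indep B0" "B \<inter> B0 = {}"
    by (auto simp: basis_def dual_indep_def)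
  then have "dual_indep E indep (E - B0)" "B \<subseteq> E - B0"
    by (auto simp: dual_indep_def)
  with B have "B = E - B0" by (metis basis_def)
  then have "E - B = B0" using basis_subset[OF B0(2)] by auto
  with B0 show "B \<subseteq> E \<and> basis indep (E - B)" by simp
next
  assume B: "B \<subseteq> E \<and> basis indep (E - B)"
  have "X = B" if X: "dual_indep E indep X" "B \<subseteq> X" for X
  proof -
    obtain B1 where B1: "X \<subseteq> E" "basis indep B1" "X \<inter> B1 = {}"
      using X by (auto simp: dual_indep_def)
    then have "B1 \<subseteq> E - B" using X basis_subset by blast
    then have "E - B = B1" using B B1 by (metis basis_def)
    then show ?thesis using B1 X by auto
  qed
  moreover have "dual_indep E indep B" using B by (auto simp: dual_indep_def)
  ultimately show "basis (dual_indep E indep) B" by (auto simp: basis_def)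
qed

lemma (in matroid) indep_extends_basis:
  assumes "indep X"
  shows "\<exists>B. basis indep B \<and> X \<subseteq> B"
proof -
  have "finite {Y. indep Y \<and> X \<subseteq> Y}"
    using finite_ground indep_subset by (auto intro: finite_subset[of _ "Pow E"])
  then obtain B where B: "indep B" "X \<subseteq> B" "\<And>Y. indep Y \<Longrightarrow> X \<subseteq> Y \<Longrightarrow> B \<subseteq> Y \<Longrightarrow> B = Y"
    using finite_has_maximal2[of "{Y. indep Y \<and> X \<subseteq> Y}" X] assms by auto
  then have "basis indep B" unfolding basis_def by blast
  then show ?thesis using B by blast
qed

lemma (in matroid) dependent_iff_circuit:
  assumes "X \<subseteq> E"
  shows "\<not> indep X \<longleftrightarrow> (\<exists>C. circuit E indep C \<and> C \<subseteq> X)"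
proof
  assume dep: "\<not> indep X"
  have "finite {Y. \<not> indep Y \<and> Y \<subseteq> X}"
    using finite_subset[OF assms finite_ground] by (auto intro: finite_subset[of _ "Pow X"])
  then obtain C where C: "\<not> indep C" "C \<subseteq> X"
      "\<And>Y. \<not> indep Y \<Longrightarrow> Y \<subseteq> X \<Longrightarrow> Y \<subseteq> C \<Longrightarrow> C = Y"
    using finite_has_minimal2[of "{Y. \<not> indep Y \<and> Y \<subseteq> X}" X] dep by auto
  then have "circuit E indep C" using assms unfolding circuit_def by blast
  then show "\<exists>C. circuit E indep C \<and> C \<subseteq> X" using C by blast
next
  assume "\<exists>C. circuit E indep C \<and> C \<subseteq> X"
  then show "\<not> indep X" unfolding circuit_def using indep_mono by metis
qed


section \<open>Polynomial rings and squarefree monomials\<close>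

text \<open>A polynomial is a finitely supported map from exponent vectors to coefficients; the
  carrier consists of the polynomials that involve only variables indexed by \<open>E\<close>.\<close>

definition mpoly_ring :: "'a set \<Rightarrow> (('a \<Rightarrow>\<^sub>0 nat) \<Rightarrow>\<^sub>0 'l::field) ring" where
  "mpoly_ring E = \<lparr> carrier = {p. \<forall>m\<in>Poly_Mapping.keys p. Poly_Mapping.keys m \<subseteq> E},
     mult = (*), one = 1, zero = 0, add = (+) \<rparr>"

definition var :: "'a \<Rightarrow> ('a \<Rightarrow>\<^sub>0 nat) \<Rightarrow>\<^sub>0 'l::field" where
  "var e = Poly_Mapping.single (Poly_Mapping.single e 1) 1"

definition sqfree_monom :: "'a set \<Rightarrow> ('a \<Rightarrow>\<^sub>0 nat) \<Rightarrow>\<^sub>0 'l::field" where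
  "sqfree_monom U = (\<Prod>u\<in>U. var u)"

definition var_ideal :: "'a set \<Rightarrow> 'a set \<Rightarrow> (('a \<Rightarrow>\<^sub>0 nat) \<Rightarrow>\<^sub>0 'l::field) set" where
  "var_ideal E U = Idl\<^bsub>mpoly_ring E\<^esub> (var ` U)"

lemma mpoly_ring_simps [simp]:
  "p \<in> carrier (mpoly_ring E) \<longleftrightarrow> (\<forall>m\<in>Poly_Mapping.keys p. Poly_Mapping.keys m \<subseteq> E)"
  "mult (mpoly_ring E) = (*)" "one (mpoly_ring E) = 1"
  "zero (mpoly_ring E) = 0" "add (mpoly_ring E) = (+)"
  by (simp_all add: mpoly_ring_def)

lemma keys_plus_nat: "Poly_Mapping.keys (a + b :: 'a \<Rightarrow>\<^sub>0 nat) = Poly_Mapping.keys a \<union> Poly_Mapping.keys b"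
  by (auto simp: in_keys_iff lookup_add)

lemma cring_mpoly_ring: "cring (mpoly_ring E :: (('a \<Rightarrow>\<^sub>0 nat) \<Rightarrow>\<^sub>0 'l::field) ring)" (is "cring ?S")
proof (rule cringI)
  have add: "p + q \<in> carrier ?S" if "p \<in> carrier ?S" "q \<in> carrier ?S" for p q
    using that Poly_Mapping.keys_add[of p q] by fastforce
  have mult: "p * q \<in> carrier ?S" if "p \<in> carrier ?S" "q \<in> carrier ?S" for p q
    using that keys_mult[of p q] by (fastforce simp: keys_plus_nat)
  show "abelian_group ?S"
  proof (rule abelian_groupI)
    show "p \<oplus>\<^bsub>?S\<^esub> q \<in> carrier ?S" if "p \<in> carrier ?S" "q \<in> carrier ?S" for p q
      using add[OF that] by simp
    show "\<exists>q\<in>carrier ?S. q \<oplus>\<^bsub>?S\<^esub> p = \<zero>\<^bsub>?S\<^esub>" if "p \<in> carrier ?S" for p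
      using that by (intro bexI[of _ "- p"]) auto
  qed (simp_all add: ac_simps)
  show "Group.comm_monoid ?S"
  proof (rule comm_monoidI)
    show "p \<otimes>\<^bsub>?S\<^esub> q \<in> carrier ?S" if "p \<in> carrier ?S" "q \<in> carrier ?S" for p q
      using mult[OF that] by simp
  qed (simp_all add: ac_simps)
qed (simp add: distrib_right)

lemma sqfree_monom_eq_single:
  "finite U \<Longrightarrow> sqfree_monom U = Poly_Mapping.single (\<Sum>u\<in>U. Poly_Mapping.single u 1) 1"
  by (induction U rule: finite_induct) (simp_all add: sqfree_monom_def var_def mult_single)

lemma keys_sum_single:
  "finite U \<Longrightarrow> Poly_Mapping.keys (\<Sum>u\<in>U. Poly_Mapping.single u (1::nat)) = U"
  by (induction U rule: finite_induct) (simp_all add: keys_plus_nat)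


section \<open>The Stanley-Reisner ideal of the independence complex and its symbolic powers\<close>

definition stanley_reisner_ideal ::
    "'a set \<Rightarrow> ('a set \<Rightarrow> bool) \<Rightarrow> (('a \<Rightarrow>\<^sub>0 nat) \<Rightarrow>\<^sub>0 'l::field) set" where
  "stanley_reisner_ideal E indep = Idl\<^bsub>mpoly_ring E\<^esub> (sqfree_monom ` {C. circuit E indep C})"

text \<open>The intersection of the powers of the components of the prime decomposition of the
  Stanley-Reisner ideal, indexed by the bases of the dual matroid; the decomposition itself is
  \<open>stanley_reisner_ideal_eq\<close> below. Powers are taken in the monoid of ideals under
  the ideal product.\<close>

definition symbolic_power ::
    "'a set \<Rightarrow> ('a set \<Rightarrow> bool) \<Rightarrow> nat \<Rightarrow> (('a \<Rightarrow>\<^sub>0 nat) \<Rightarrow>\<^sub>0 'l::field) set" where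
  "symbolic_power E indep s =
     (\<Inter>B\<in>{B. basis (dual_indep E indep) B}. var_ideal E B [^]\<^bsub>ideals_set (mpoly_ring E)\<^esub> s)"

lemma sqfree_monomial_ideal:
  assumes "finite E" "\<F> \<subseteq> Pow E"
  shows "Idl\<^bsub>mpoly_ring E\<^esub> (sqfree_monom ` \<F>) =
    {p :: ('a \<Rightarrow>\<^sub>0 nat) \<Rightarrow>\<^sub>0 'l::field. \<forall>m\<in>Poly_Mapping.keys p.
       Poly_Mapping.keys m \<subseteq> E \<and> (\<exists>U\<in>\<F>. U \<subseteq> Poly_Mapping.keys m)}" (is "_ = ?I")
proof -
  interpret S: cring "mpoly_ring E :: (('a \<Rightarrow>\<^sub>0 nat) \<Rightarrow>\<^sub>0 'l) ring" by (rule cring_mpoly_ring)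
  let ?S = "mpoly_ring E :: (('a \<Rightarrow>\<^sub>0 nat) \<Rightarrow>\<^sub>0 'l) ring"
  let ?G = "sqfree_monom ` \<F> :: (('a \<Rightarrow>\<^sub>0 nat) \<Rightarrow>\<^sub>0 'l) set"
  have fin: "finite U" if "U \<in> \<F>" for U
    using that assms finite_subset by blast
  have carr: "?G \<subseteq> carrier ?S"
    using assms fin by (auto simp: sqfree_monom_eq_single keys_sum_single simp del: One_nat_def split: if_splits)
  have mult: "p * q \<in> ?I" if "p \<in> ?I" "q \<in> carrier ?S" for p q
  proof (intro CollectI ballI)
    fix m assume "m \<in> Poly_Mapping.keys (p * q)"
    then obtain a b where ab: "m = a + b" "a \<in> Poly_Mapping.keys p" "b \<in> Poly_Mapping.keys q"
      using keys_mult[of p q] by blast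
    then obtain U where "U \<in> \<F>" "U \<subseteq> Poly_Mapping.keys a" using \<open>p \<in> ?I\<close> by blast
    moreover have "Poly_Mapping.keys a \<subseteq> E" using ab \<open>p \<in> ?I\<close> by blast
    moreover have "Poly_Mapping.keys b \<subseteq> E" using ab \<open>q \<in> carrier ?S\<close> by simp
    ultimately show "Poly_Mapping.keys m \<subseteq> E \<and> (\<exists>U\<in>\<F>. U \<subseteq> Poly_Mapping.keys m)"
      unfolding ab(1) keys_plus_nat by blast
  qed
  have id: "ideal ?I ?S"
  proof (rule idealI)
    show "ring ?S" by (rule S.ring_axioms)
    show "subgroup ?I (add_monoid ?S)"
    proof (rule S.add.subgroupI)
      have inv: "\<ominus>\<^bsub>?S\<^esub> p = - p" if "p \<in> carrier ?S" for p
        using that by (intro S.minus_equality) auto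
      show "\<ominus>\<^bsub>?S\<^esub> p \<in> ?I" if "p \<in> ?I" for p
        using that by (subst inv) auto
      show "p \<oplus>\<^bsub>?S\<^esub> q \<in> ?I" if "p \<in> ?I" "q \<in> ?I" for p q
        using that Poly_Mapping.keys_add[of p q] by (simp add: subset_iff) blast
      show "?I \<noteq> {}" by (auto intro!: exI[of _ 0])
    qed auto
    show "q \<otimes>\<^bsub>?S\<^esub> p \<in> ?I" "p \<otimes>\<^bsub>?S\<^esub> q \<in> ?I" if "p \<in> ?I" "q \<in> carrier ?S" for p q
      using mult[OF that] by (simp_all add: mult.commute)
  qed
  have "?G \<subseteq> ?I"
  proof safe
    fix U m
    assume U: "U \<in> \<F>" and "m \<in> Poly_Mapping.keys (sqfree_monom U :: ('a \<Rightarrow>\<^sub>0 nat) \<Rightarrow>\<^sub>0 'l)"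
    then have m: "Poly_Mapping.keys m = U"
      using fin[OF U] keys_sum_single[of U] by (simp add: sqfree_monom_eq_single split: if_splits)
    then show "\<exists>U\<in>\<F>. U \<subseteq> Poly_Mapping.keys m" using U by blast
    show "e \<in> E" if "e \<in> Poly_Mapping.keys m" for e using that m U assms by blast
  qed
  then have le: "Idl\<^bsub>?S\<^esub> ?G \<subseteq> ?I" by (rule S.genideal_minimal[OF id])
  interpret G: ideal "Idl\<^bsub>?S\<^esub> ?G" ?S by (rule S.genideal_ideal[OF carr])
  have mono: "Poly_Mapping.single m c \<in> Idl\<^bsub>?S\<^esub> ?G"
    if m: "Poly_Mapping.keys m \<subseteq> E" "U \<in> \<F>" "U \<subseteq> Poly_Mapping.keys m" for m c U
  proof -
    let ?u = "\<Sum>u\<in>U. Poly_Mapping.single u (1::nat)"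
    have u: "Poly_Mapping.lookup ?u e = (if e \<in> U then 1 else 0)" for e
      using fin[OF m(2)] by (simp add: lookup_sum lookup_single when_def)
    have "?u + (m - ?u) = m"
      using m by (intro poly_mapping_eqI)
        (auto simp: lookup_add lookup_minus u in_keys_iff subset_iff Suc_le_eq simp del: One_nat_def)
    then have eq: "Poly_Mapping.single m c = sqfree_monom U * Poly_Mapping.single (m - ?u) c"
      by (simp add: sqfree_monom_eq_single[OF fin[OF m(2)]] mult_single)
    have "Poly_Mapping.keys (m - ?u) \<subseteq> Poly_Mapping.keys m"
      by (auto simp: in_keys_iff lookup_minus)
    then have "Poly_Mapping.single (m - ?u) c \<in> carrier ?S" using m by auto
    moreover have "sqfree_monom U \<in> Idl\<^bsub>?S\<^esub> ?G" using S.genideal_self[OF carr] m by blast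
    ultimately show ?thesis using G.I_r_closed unfolding eq by fastforce
  qed
  have sum: "(\<Sum>m\<in>A. Poly_Mapping.single m (f m)) \<in> Idl\<^bsub>?S\<^esub> ?G"
    if "finite A" "\<And>m. m \<in> A \<Longrightarrow> Poly_Mapping.single m (f m) \<in> Idl\<^bsub>?S\<^esub> ?G" for A f
    using that
  proof (induction A rule: finite_induct)
    case empty
    then show ?case using G.zero_closed by simp
  next
    case (insert m A)
    then show ?case using G.a_closed[of "Poly_Mapping.single m (f m)"] by simp
  qed
  have "?I \<subseteq> Idl\<^bsub>?S\<^esub> ?G"
  proof
    fix p assume p: "p \<in> ?I"
    have "p = (\<Sum>m\<in>Poly_Mapping.keys p. Poly_Mapping.single m (Poly_Mapping.lookup p m))"
      by (intro poly_mapping_eqI)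
        (auto simp: lookup_sum lookup_single when_def sum.delta' in_keys_iff)
    also have "\<dots> \<in> Idl\<^bsub>?S\<^esub> ?G" using p mono by (intro sum) auto
    finally show "p \<in> Idl\<^bsub>?S\<^esub> ?G" .
  qed
  with le show ?thesis by blast
qed

lemma var_ideal_eq:
  assumes "finite E" "U \<subseteq> E"
  shows "var_ideal E U = {p :: ('a \<Rightarrow>\<^sub>0 nat) \<Rightarrow>\<^sub>0 'l::field. \<forall>m\<in>Poly_Mapping.keys p.
       Poly_Mapping.keys m \<subseteq> E \<and> U \<inter> Poly_Mapping.keys m \<noteq> {}}"
proof -
  have "(var ` U :: (('a \<Rightarrow>\<^sub>0 nat) \<Rightarrow>\<^sub>0 'l) set) = sqfree_monom ` (\<lambda>u. {u}) ` U"
    by (auto simp: sqfree_monom_def image_iff)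
  moreover have "(\<lambda>u. {u}) ` U \<subseteq> Pow E" using assms by auto
  ultimately show ?thesis
    unfolding var_ideal_def by (simp add: sqfree_monomial_ideal[OF assms(1)]) blast
qed

lemma (in matroid) stanley_reisner_ideal_eq:
  "(stanley_reisner_ideal E indep :: (('a \<Rightarrow>\<^sub>0 nat) \<Rightarrow>\<^sub>0 'l::field) set) =
     (\<Inter>B\<in>{B. basis (dual_indep E indep) B}. var_ideal E B)"
proof -
  have sub: "{C. circuit E indep C} \<subseteq> Pow E" by (auto simp: circuit_def)
  have circ: "(\<exists>C. circuit E indep C \<and> C \<subseteq> T) \<longleftrightarrow>
      (\<forall>B. basis (dual_indep E indep) B \<longrightarrow> B \<inter> T \<noteq> {})" if T: "T \<subseteq> E" for T
  proof -
    have "indep T \<longleftrightarrow> (\<exists>B. basis indep B \<and> T \<subseteq> B)"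
      using indep_extends_basis indep_mono by (auto simp: basis_def)
    also have "\<dots> \<longleftrightarrow> (\<exists>B. basis (dual_indep E indep) B \<and> B \<inter> T = {})"
    proof safe
      fix B assume "basis indep B" "T \<subseteq> B"
      then show "\<exists>B. basis (dual_indep E indep) B \<and> B \<inter> T = {}"
        using basis_subset[of B] by (intro exI[of _ "E - B"]) (auto simp: basis_dual_iff double_diff)
    next
      fix B assume "basis (dual_indep E indep) B" "B \<inter> T = {}"
      then show "\<exists>B. basis indep B \<and> T \<subseteq> B"
        using T by (intro exI[of _ "E - B"]) (auto simp: basis_dual_iff)
    qed
    finally show ?thesis using dependent_iff_circuit[OF T] by blast
  qed
  have ex: "\<exists>B. basis (dual_indep E indep) B"
  proof -
    obtain B where "basis indep B" using indep_extends_basis[OF indep_empty] by blast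
    then show ?thesis
      using basis_subset[of B] by (intro exI[of _ "E - B"]) (auto simp: basis_dual_iff double_diff)
  qed
  have var: "var_ideal E B = {p :: ('a \<Rightarrow>\<^sub>0 nat) \<Rightarrow>\<^sub>0 'l. \<forall>m\<in>Poly_Mapping.keys p.
       Poly_Mapping.keys m \<subseteq> E \<and> B \<inter> Poly_Mapping.keys m \<noteq> {}}"
    if "basis (dual_indep E indep) B" for B
    using that var_ideal_eq[OF finite_ground] by (auto simp: basis_dual_iff)
  show ?thesis
  proof (rule Set.set_eqI)
    fix p :: "('a \<Rightarrow>\<^sub>0 nat) \<Rightarrow>\<^sub>0 'l"
    have "p \<in> stanley_reisner_ideal E indep \<longleftrightarrow> (\<forall>m\<in>Poly_Mapping.keys p. Poly_Mapping.keys m \<subseteq> E \<and>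
        (\<exists>C. circuit E indep C \<and> C \<subseteq> Poly_Mapping.keys m))"
      by (simp add: stanley_reisner_ideal_def sqfree_monomial_ideal[OF finite_ground sub])
    also have "\<dots> \<longleftrightarrow> (\<forall>m\<in>Poly_Mapping.keys p. Poly_Mapping.keys m \<subseteq> E \<and>
        (\<forall>B. basis (dual_indep E indep) B \<longrightarrow> B \<inter> Poly_Mapping.keys m \<noteq> {}))"
      using circ by (intro ball_cong) auto
    also have "\<dots> \<longleftrightarrow> (\<forall>B. basis (dual_indep E indep) B \<longrightarrow> p \<in> var_ideal E B)"
    proof -
      have "p \<in> var_ideal E B \<longleftrightarrow> (\<forall>m\<in>Poly_Mapping.keys p.
          Poly_Mapping.keys m \<subseteq> E \<and> B \<inter> Poly_Mapping.keys m \<noteq> {})"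
        if "basis (dual_indep E indep) B" for B
        using var[OF that] by simp
      then show ?thesis using ex by meson
    qed
    finally show "p \<in> stanley_reisner_ideal E indep \<longleftrightarrow>
        p \<in> (\<Inter>B\<in>{B. basis (dual_indep E indep) B}. var_ideal E B)" by simp
  qed
qed

end

theory Submission
  imports Defs
begin

text \<open>A squarefree monomial \<open>x\<^sup>J\<close> lies in \<open>P\<^sub>B\<^sup>s\<close> exactly when
  \<open>\<bar>J \<inter> B\<bar> \<ge> s\<close>. The bases of the dual are the complements of the bases \<open>B\<close> of \<open>M\<close>, so
  \<open>x\<^sup>J\<close> lies in the \<open>r\<close>-th symbolic power iff \<open>\<bar>J\<bar> - max\<^sub>B \<bar>J \<inter> B\<bar> \<ge> r\<close>, and this maximum is the
  rank of \<open>J\<close>. A smallest set of nullity at least \<open>r\<close> has nullity exactly \<open>r\<close>, because deleting an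
  element lowers the nullity by at most one. Finally, complementation exchanges sets of nullity \<open>r\<close>
  with sets of dual rank \<open>n - k - r\<close>, and a largest set of given rank is a flat.\<close>

section \<open>Rank and nullity\<close>

lemma finite_card_subsets: "finite E \<Longrightarrow> finite {card U | U. U \<subseteq> E \<and> P U}"
  by (rule finite_image_set) (rule finite_subset[of _ "Pow E"], auto)

text \<open>The rank facts are stated for a predicate \<open>indep\<close> rather than inside the
  locale, so that they also apply to \<open>dual_indep E indep\<close>, which is not shown here to
  be a matroid.\<close>

lemma rk_attained:
  assumes "finite U" "indep {}"
  obtains X where "X \<subseteq> U" "indep X" "card X = rk indep U"
proof -
  have "{card X | X. X \<subseteq> U \<and> indep X} \<noteq> {}"
    using assms(2) by blast
  then have "rk indep U \<in> {card X | X. X \<subseteq> U \<and> indep X}"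
    unfolding rk_def using finite_card_subsets[OF assms(1)] by (intro Max_in)
  then show thesis using that by auto
qed

lemma card_le_rk: "finite U \<Longrightarrow> X \<subseteq> U \<Longrightarrow> indep X \<Longrightarrow> card X \<le> rk indep U"
  unfolding rk_def by (rule Max_ge[OF finite_card_subsets]) auto

lemma rk_mono:
  assumes "finite V" "U \<subseteq> V" "indep {}"
  shows "rk indep U \<le> rk indep V"
proof -
  obtain X where "X \<subseteq> U" "indep X" "card X = rk indep U"
    using rk_attained finite_subset[OF assms(2,1)] assms(3) .
  then show ?thesis using card_le_rk[of V X indep] assms by force
qed

lemma rk_le_card:
  assumes "finite U" "indep {}"
  shows "rk indep U \<le> card U"
  using rk_attained[of U indep] assms card_mono by metis

text \<open>Adding an element to \<open>F\<close> makes a larger set, whose rank must then differ;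
  by monotonicity it can only be greater.\<close>

lemma largest_of_rank_is_flat:
  assumes "finite E" "indep {}" "F \<subseteq> E"
    and largest: "\<And>G. G \<subseteq> E \<Longrightarrow> rk indep G = rk indep F \<Longrightarrow> card G \<le> card F"
  shows "flat E indep F"
  unfolding flat_def
proof (intro conjI ballI)
  fix e assume e: "e \<in> E - F"
  have fin: "finite F" using assms finite_subset by blast
  have "rk indep (insert e F) \<noteq> rk indep F"
    using largest[of "insert e F"] e assms(3) fin by auto
  moreover have "rk indep F \<le> rk indep (insert e F)"
    using fin assms(2) by (intro rk_mono) auto
  ultimately show "rk indep F < rk indep (insert e F)" by simp
qed (fact assms(3))

section \<open>Rank through bases, and nullity\<close>

context matroid
begin

lemma finite_subset_ground: "U \<subseteq> E \<Longrightarrow> finite U"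
  using finite_ground finite_subset by blast

text \<open>A basis smaller than a largest independent set could be augmented from it, against
  maximality.\<close>

lemma card_basis:
  assumes "basis indep B"
  shows "card B = rk indep E"
proof -
  obtain X where X: "X \<subseteq> E" "indep X" "card X = rk indep E"
    using rk_attained finite_ground indep_empty .
  have "\<not> card B < card X"
  proof
    assume "card B < card X"
    then obtain y where "y \<in> X - B" "indep (insert y B)"
      using indep_augment[of B X] assms X by (auto simp: basis_def)
    then show False using assms by (auto simp: basis_def)
  qed
  moreover have "card B \<le> rk indep E"
    using assms basis_subset finite_ground by (intro card_le_rk) (auto simp: basis_def)
  ultimately show ?thesis using X by simp
qed

lemma card_Int_basis_le_rk:
  assumes "basis indep B" "U \<subseteq> E"
  shows "card (U \<inter> B) \<le> rk indep U"
  using assms finite_subset_ground indep_mono[of B "U \<inter> B"]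
  by (intro card_le_rk) (auto simp: basis_def)

text \<open>A largest independent subset of \<open>U\<close> extends to a basis \<open>B\<close>; as
  \<open>U \<inter> B\<close> is itself independent, it cannot be larger.\<close>

lemma basis_Int_rk:
  assumes "U \<subseteq> E"
  obtains B where "basis indep B" "card (U \<inter> B) = rk indep U"
proof -
  obtain X where X: "X \<subseteq> U" "indep X" "card X = rk indep U"
    using rk_attained finite_subset_ground[OF assms] indep_empty .
  then obtain B where B: "basis indep B" "X \<subseteq> B" using indep_extends_basis by blast
  have "card X \<le> card (U \<inter> B)"
    using X B finite_subset_ground[OF assms] by (intro card_mono) auto
  then show thesis using that[OF B(1)] X card_Int_basis_le_rk[OF B(1) assms] by simp
qed

text \<open>The nullity is the minimum of \<open>card (U - B)\<close> over all bases
  \<open>B\<close>, since \<open>card (U \<inter> B)\<close> is at most the rank and some basis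
  attains it. A condition on all bases is what membership in an intersection of ideals
  yields.\<close>

lemma nullity_ge_iff:
  assumes "U \<subseteq> E"
  shows "r \<le> card U - rk indep U \<longleftrightarrow> (\<forall>B. basis indep B \<longrightarrow> r \<le> card (U - B))"
proof -
  have diff: "card (U - B) = card U - card (U \<inter> B)" for B
    using finite_subset_ground[OF assms] by (simp add: card_Diff_subset_Int)
  obtain B where B: "basis indep B" "card (U \<inter> B) = rk indep U"
    using basis_Int_rk[OF assms] .
  have "card U - rk indep U \<le> card (U - B)" if "basis indep B" for B
    using diff_le_mono2[OF card_Int_basis_le_rk[OF that assms]] by (simp add: diff)
  moreover have "card U - rk indep U = card (U - B)" by (simp add: diff B(2))
  ultimately show ?thesis using B(1) by (metis order_trans)
qed

text \<open>The cardinality drops by exactly one and the rank cannot grow.\<close>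

lemma nullity_remove:
  assumes "U \<subseteq> E" "e \<in> U"
  shows "card U - rk indep U \<le> Suc (card (U - {e}) - rk indep (U - {e}))"
proof -
  have fin: "finite U" by (rule finite_subset_ground[OF assms(1)])
  have "rk indep (U - {e}) \<le> rk indep U"
    using fin indep_empty by (intro rk_mono) auto
  moreover have "card U = Suc (card (U - {e}))"
    using card.remove[OF fin assms(2)] by simp
  ultimately show ?thesis by simp
qed

section \<open>Generalized Hamming weights as minimal cardinalities\<close>

lemma smallest_of_nullity_ge:
  assumes "U \<subseteq> E" "r \<le> card U - rk indep U"
    and smallest: "\<And>V. V \<subseteq> E \<Longrightarrow> r \<le> card V - rk indep V \<Longrightarrow> card U \<le> card V"
  shows "card U - rk indep U = r"
proof (rule ccontr)
  assume "card U - rk indep U \<noteq> r"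
  then have gt: "r < card U - rk indep U" using assms(2) by simp
  then obtain e where e: "e \<in> U" by fastforce
  have "r \<le> card (U - {e}) - rk indep (U - {e})"
    using nullity_remove[OF assms(1) e] gt by simp
  then have "card U \<le> card (U - {e})"
    using smallest assms(1) by blast
  then show False using card_Diff1_less[OF finite_subset_ground[OF assms(1)] e] by simp
qed

text \<open>A minimizer over the larger family of sets of nullity at least \<open>r\<close> has
  nullity exactly \<open>r\<close>, so it also attains the weight. The last clause keeps the
  stronger minimality, on which the characterizations by nullity and by flats both rest.\<close>

lemma gen_hamming_weight_attained:
  assumes "r \<le> card E - rk indep E"
  obtains U where "U \<subseteq> E" "card U - rk indep U = r" "card U = gen_hamming_weight E indep r"
    and "\<And>V. V \<subseteq> E \<Longrightarrow> r \<le> card V - rk indep V \<Longrightarrow> card U \<le> card V"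
proof -
  \<comment> \<open>The hypothesis on \<open>r\<close> says that \<open>E\<close> itself is a
    candidate.\<close>
  obtain U where U: "U \<subseteq> E" "r \<le> card U - rk indep U"
      "\<And>V. V \<subseteq> E \<Longrightarrow> r \<le> card V - rk indep V \<Longrightarrow> card U \<le> card V"
    using ex_has_least_nat[of "\<lambda>U. U \<subseteq> E \<and> r \<le> card U - rk indep U" E card] assms by auto
  have null: "card U - rk indep U = r" using U by (rule smallest_of_nullity_ge)
  have "gen_hamming_weight E indep r = card U"
    unfolding gen_hamming_weight_def
  proof (rule Min_eqI)
    show "finite {card U | U. U \<subseteq> E \<and> card U - rk indep U = r}"
      by (rule finite_card_subsets[OF finite_ground])
  qed (use U null in auto)
  then show thesis using that U null by simp
qed

lemma gen_hamming_weight_eq_Min_ge: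
  assumes "r \<le> card E - rk indep E"
  shows "gen_hamming_weight E indep r = Min {card U | U. U \<subseteq> E \<and> r \<le> card U - rk indep U}"
proof -
  obtain U where U: "U \<subseteq> E" "card U - rk indep U = r" "card U = gen_hamming_weight E indep r"
    "\<And>V. V \<subseteq> E \<Longrightarrow> r \<le> card V - rk indep V \<Longrightarrow> card U \<le> card V"
    using gen_hamming_weight_attained[OF assms] by blast
  have "Min {card U | U. U \<subseteq> E \<and> r \<le> card U - rk indep U} = card U"
  proof (rule Min_eqI)
    show "finite {card U | U. U \<subseteq> E \<and> r \<le> card U - rk indep U}"
      by (rule finite_card_subsets[OF finite_ground])
  qed (use U(1,2,4) in auto)
  then show ?thesis using U by simp
qed


section \<open>The dual rank function\<close>

lemma dual_indep_empty: "dual_indep E indep {}"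
  using indep_extends_basis[OF indep_empty] by (auto simp: dual_indep_def)

text \<open>Stated additively to avoid truncated subtraction.\<close>

lemma rk_dual:
  assumes "U \<subseteq> E"
  shows "rk (dual_indep E indep) U + rk indep E = card U + rk indep (E - U)"
proof (rule antisym)
  have fin: "finite U" by (rule finite_subset_ground[OF assms])
  \<comment> \<open>Both sides equal \<open>card (U \<union> B)\<close>. Maximizing over
    \<open>B\<close> turns the left side into \<open>card U + rk indep (E - U)\<close> and the right
    side into \<open>rk (dual_indep E indep) U + rk indep E\<close>.\<close>
  have card_U: "card U + card ((E - U) \<inter> B) = card (U - B) + rk indep E" if "basis indep B" for B
  proof -
    have "finite B" using finite_subset_ground basis_subset that by blast
    then have "card B = card (B \<inter> U) + card (B - U)" by (rule card_Int_Diff)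
    moreover have "card U = card (U \<inter> B) + card (U - B)" using fin by (rule card_Int_Diff)
    moreover have "B - U = (E - U) \<inter> B" using basis_subset[OF that] by blast
    ultimately show ?thesis using card_basis[OF that] by (simp add: Int_commute)
  qed
  obtain Y where Y: "Y \<subseteq> U" "dual_indep E indep Y" "card Y = rk (dual_indep E indep) U"
    using rk_attained[of U "dual_indep E indep"] fin dual_indep_empty .
  then obtain B where B: "basis indep B" "Y \<inter> B = {}" by (auto simp: dual_indep_def)
  have "card Y \<le> card (U - B)" using Y B fin by (intro card_mono) auto
  then show "rk (dual_indep E indep) U + rk indep E \<le> card U + rk indep (E - U)"
    using Y card_U[OF B(1)] card_Int_basis_le_rk[OF B(1), of "E - U"] by auto
  obtain B' where B': "basis indep B'" "card ((E - U) \<inter> B') = rk indep (E - U)"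
    using basis_Int_rk[of "E - U"] by blast
  have "dual_indep E indep (U - B')"
    using B' assms by (auto simp: dual_indep_def)
  then have "card (U - B') \<le> rk (dual_indep E indep) U"
    using fin by (intro card_le_rk) auto
  then show "card U + rk indep (E - U) \<le> rk (dual_indep E indep) U + rk indep E"
    using card_U[OF B'(1)] B'(2) by simp
qed

lemma rk_dual_eq_iff:
  assumes "F \<subseteq> E" "r \<le> card E - rk indep E"
  shows "rk (dual_indep E indep) F = card E - rk indep E - r \<longleftrightarrow>
    card (E - F) - rk indep (E - F) = r"
proof -
  have "card E = card F + card (E - F)"
    using assms(1) finite_ground finite_subset_ground
    by (metis card_Diff_subset card_mono le_add_diff_inverse)
  \<comment> \<open>With the bound on \<open>r\<close>, these make every truncated subtraction in
    the goal an ordinary one.\<close>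
  moreover have "rk indep (E - F) \<le> card (E - F)" "rk indep E \<le> card E"
    using finite_ground indep_empty by (auto intro!: rk_le_card)
  ultimately show ?thesis using rk_dual[OF assms(1)] assms(2) by linarith
qed

text \<open>The complement of the minimizer \<open>U\<close> is largest among all sets of the given
  dual rank. Being largest it is a flat, so restricting the maximum to flats loses nothing.\<close>

lemma gen_hamming_weight_eq_flat:
  assumes "r \<le> card E - rk indep E"
  shows "gen_hamming_weight E indep r = card E - Max {card F | F. flat E (dual_indep E indep) F \<and>
    rk (dual_indep E indep) F = card E - rk indep E - r}"
proof -
  obtain U where U: "U \<subseteq> E" "card U - rk indep U = r" "card U = gen_hamming_weight E indep r"
    and least: "\<And>V. V \<subseteq> E \<Longrightarrow> r \<le> card V - rk indep V \<Longrightarrow> card U \<le> card V"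
    using gen_hamming_weight_attained[OF assms] by blast
  have card_compl: "card (E - V) = card E - card V" "card V \<le> card E" if "V \<subseteq> E" for V
    using that finite_ground by (auto simp: card_Diff_subset finite_subset_ground card_mono)
  have UU: "E - (E - U) = U" using U(1) by blast
  have rk: "rk (dual_indep E indep) (E - U) = card E - rk indep E - r"
    using rk_dual_eq_iff[of "E - U"] assms U(2) UU by auto
  have largest: "card F \<le> card (E - U)"
    if "F \<subseteq> E" "rk (dual_indep E indep) F = card E - rk indep E - r" for F
  proof -
    have "card U \<le> card (E - F)"
      using that rk_dual_eq_iff[OF that(1) assms] by (intro least) auto
    then show ?thesis using card_compl[OF that(1)] card_compl[OF U(1)] by simp
  qed
  have "flat E (dual_indep E indep) (E - U)"
    using finite_ground dual_indep_empty rk largest by (intro largest_of_rank_is_flat) auto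
  then have "Max {card F | F. flat E (dual_indep E indep) F \<and>
      rk (dual_indep E indep) F = card E - rk indep E - r} = card (E - U)"
  proof (intro Max_eqI)
    show "finite {card F | F. flat E (dual_indep E indep) F \<and>
        rk (dual_indep E indep) F = card E - rk indep E - r}"
      unfolding flat_def conj_assoc by (rule finite_card_subsets[OF finite_ground])
  qed (use rk largest in \<open>auto simp: flat_def\<close>)
  then show ?thesis using card_compl[OF U(1)] U(3) by simp
qed

end


section \<open>Squarefree monomials in symbolic powers\<close>

lemma ideals_pow_Suc: "I [^]\<^bsub>ideals_set R\<^esub> Suc s = ideal_prod R (I [^]\<^bsub>ideals_set R\<^esub> s) I"
  and ideals_pow_0: "I [^]\<^bsub>ideals_set R\<^esub> (0::nat) = carrier R"
  by (simp_all add: nat_pow_def ideals_set_def)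

text \<open>The degree of a monomial in the variables of \<open>B\<close> is additive under
  multiplication, and it is at least 1 for every monomial occurring in an element of
  \<open>var_ideal E B\<close>. Each further factor of the power therefore adds at least 1.\<close>

lemma var_ideal_pow_keys:
  fixes p :: "('a \<Rightarrow>\<^sub>0 nat) \<Rightarrow>\<^sub>0 'l::field"
  assumes "finite E" "B \<subseteq> E" "p \<in> var_ideal E B [^]\<^bsub>ideals_set (mpoly_ring E)\<^esub> s"
    and "m \<in> Poly_Mapping.keys p"
  shows "s \<le> (\<Sum>b\<in>B. Poly_Mapping.lookup m b)"
  using assms(3,4)
proof (induction s arbitrary: p m)
  case (Suc s)
  have finB: "finite B" using assms finite_subset by blast
  \<comment> \<open>Elements of an ideal product are generated by products and sums, so an inner
    induction follows this generation; the keys of a sum lie among those of its summands.\<close>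
  from Suc.prems(1)[unfolded ideals_pow_Suc] Suc.prems(2) show ?case
  proof (induction arbitrary: m rule: ideal_prod.induct)
    case (prod p q)
    then obtain a b where ab: "m = a + b" "a \<in> Poly_Mapping.keys p" "b \<in> Poly_Mapping.keys q"
      using keys_mult[of p q] by auto
    have "s \<le> (\<Sum>e\<in>B. Poly_Mapping.lookup a e)"
      using Suc.IH prod.hyps(1) ab(2) .
    moreover obtain e where e: "e \<in> B" "0 < Poly_Mapping.lookup b e"
      using prod.hyps(2) ab(3) unfolding var_ideal_eq[OF assms(1,2)]
      by (force simp: in_keys_iff[of _ b])
    have "1 \<le> (\<Sum>e\<in>B. Poly_Mapping.lookup b e)"
      using member_le_sum[of e B "Poly_Mapping.lookup b"] e finB by simp
    ultimately show ?case by (simp add: ab(1) lookup_add sum.distrib)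
  next
    case (sum p q)
    then show ?case using Poly_Mapping.keys_add[of p q] by auto
  qed
qed simp

text \<open>Each of \<open>s\<close> elements of \<open>J \<inter> B\<close> supplies one factor
  from \<open>var_ideal E B\<close>; the rest of the monomial lies in the zeroth power, which is the
  whole ring.\<close>

lemma sqfree_monom_in_var_ideal_pow:
  assumes "finite E" "B \<subseteq> E" "J \<subseteq> E" "s \<le> card (J \<inter> B)"
  shows "(sqfree_monom J :: ('a \<Rightarrow>\<^sub>0 nat) \<Rightarrow>\<^sub>0 'l::field) \<in>
    var_ideal E B [^]\<^bsub>ideals_set (mpoly_ring E)\<^esub> s"
  using assms(3,4)
proof (induction s arbitrary: J)
  case 0
  then show ?case
    using finite_subset[OF 0(1) assms(1)]
    unfolding ideals_pow_0 by (simp add: sqfree_monom_eq_single keys_sum_single del: One_nat_def)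
next
  case (Suc s)
  have fin: "finite J" using Suc.prems assms finite_subset by blast
  have "J \<inter> B \<noteq> {}" using Suc.prems(2) by auto
  then obtain b where b: "b \<in> J" "b \<in> B" by blast
  have "(J - {b}) \<inter> B = J \<inter> B - {b}" by blast
  then have "s \<le> card ((J - {b}) \<inter> B)" using Suc.prems(2) b fin by simp
  then have "(sqfree_monom (J - {b}) :: ('a \<Rightarrow>\<^sub>0 nat) \<Rightarrow>\<^sub>0 'l) \<in>
      var_ideal E B [^]\<^bsub>ideals_set (mpoly_ring E)\<^esub> s"
    using Suc.prems(1) by (intro Suc.IH) auto
  moreover have "(var b :: ('a \<Rightarrow>\<^sub>0 nat) \<Rightarrow>\<^sub>0 'l) \<in> var_ideal E B"
    using b assms(2) by (auto simp: var_ideal_eq[OF assms(1,2)] var_def)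
  ultimately have "(sqfree_monom (J - {b}) * var b :: ('a \<Rightarrow>\<^sub>0 nat) \<Rightarrow>\<^sub>0 'l) \<in>
      var_ideal E B [^]\<^bsub>ideals_set (mpoly_ring E)\<^esub> Suc s"
    unfolding ideals_pow_Suc using ideal_prod.prod[where R = "mpoly_ring E"] by fastforce
  moreover have "sqfree_monom J = sqfree_monom (J - {b}) * (var b :: ('a \<Rightarrow>\<^sub>0 nat) \<Rightarrow>\<^sub>0 'l)"
    unfolding sqfree_monom_def using prod.remove[OF fin b(1), of var] by (simp add: mult.commute)
  ultimately show ?case by simp
qed

lemma sqfree_monom_in_var_ideal_pow_iff:
  assumes "finite E" "B \<subseteq> E" "J \<subseteq> E"
  shows "(sqfree_monom J :: ('a \<Rightarrow>\<^sub>0 nat) \<Rightarrow>\<^sub>0 'l::field) \<in>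
      var_ideal E B [^]\<^bsub>ideals_set (mpoly_ring E)\<^esub> s \<longleftrightarrow> s \<le> card (J \<inter> B)"
proof
  assume mem: "(sqfree_monom J :: ('a \<Rightarrow>\<^sub>0 nat) \<Rightarrow>\<^sub>0 'l) \<in>
    var_ideal E B [^]\<^bsub>ideals_set (mpoly_ring E)\<^esub> s"
  let ?m = "\<Sum>u\<in>J. Poly_Mapping.single u (1::nat)"
  have fin: "finite J" "finite B" using assms finite_subset by blast+
  have "?m \<in> Poly_Mapping.keys (sqfree_monom J :: ('a \<Rightarrow>\<^sub>0 nat) \<Rightarrow>\<^sub>0 'l)"
    by (simp add: sqfree_monom_eq_single[OF fin(1)])
  then have "s \<le> (\<Sum>b\<in>B. Poly_Mapping.lookup ?m b)"
    by (rule var_ideal_pow_keys[OF assms(1,2) mem])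
  \<comment> \<open>The exponent vector \<open>?m\<close> is the indicator function of
    \<open>J\<close>.\<close>
  also have "\<dots> = (\<Sum>b\<in>B. if b \<in> J then 1 else 0)"
    using fin by (intro sum.cong) (auto simp: lookup_sum lookup_single when_def)
  also have "\<dots> = card (J \<inter> B)"
    using fin by (simp add: sum.If_cases Int_commute)
  finally show "s \<le> card (J \<inter> B)" .
qed (rule sqfree_monom_in_var_ideal_pow[OF assms])

text \<open>Each dual basis \<open>B\<close> contributes the condition
  \<open>s \<le> card (J \<inter> B)\<close>. Passing to complements makes this
  \<open>s \<le> card (J - B)\<close> for each basis \<open>B\<close> of the matroid, and the
  minimum of these cardinalities is the nullity.\<close>

lemma (in matroid) sqfree_monom_in_symbolic_power_iff:
  assumes "J \<subseteq> E"
  shows "(sqfree_monom J :: ('a \<Rightarrow>\<^sub>0 nat) \<Rightarrow>\<^sub>0 'l::field) \<in> symbolic_power E indep s \<longleftrightarrow>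
    s \<le> card J - rk indep J"
proof -
  have "(sqfree_monom J :: ('a \<Rightarrow>\<^sub>0 nat) \<Rightarrow>\<^sub>0 'l) \<in> symbolic_power E indep s \<longleftrightarrow>
      (\<forall>B. B \<subseteq> E \<and> basis indep (E - B) \<longrightarrow> s \<le> card (J \<inter> B))"
    by (auto simp: symbolic_power_def basis_dual_iff
        sqfree_monom_in_var_ideal_pow_iff[OF finite_ground _ assms])
  also have "\<dots> \<longleftrightarrow> (\<forall>B. basis indep B \<longrightarrow> s \<le> card (J - B))"
  proof safe
    fix B assume "\<forall>B. B \<subseteq> E \<and> basis indep (E - B) \<longrightarrow> s \<le> card (J \<inter> B)" "basis indep B"
    moreover have "E - (E - B) = B" using basis_subset[OF \<open>basis indep B\<close>] by blast
    moreover have "J \<inter> (E - B) = J - B" using assms by blast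
    ultimately show "s \<le> card (J - B)" by (metis Diff_subset)
  next
    fix B assume "\<forall>B. basis indep B \<longrightarrow> s \<le> card (J - B)" "B \<subseteq> E" "basis indep (E - B)"
    moreover have "J - (E - B) = J \<inter> B" using assms by blast
    ultimately show "s \<le> card (J \<inter> B)" by metis
  qed
  finally show ?thesis by (simp add: nullity_ge_iff[OF assms])
qed

theorem corollary3p2:
  fixes E :: "'a set" and indep :: "'a set \<Rightarrow> bool" and n k r :: nat
  assumes "matroid E indep"
    and "card E = n"
    and "rk indep E = k"
    and "r \<in> {1..n - k}"
  shows
    "gen_hamming_weight E indep r =
       Min {card J | J. J \<subseteq> E \<and>
         (sqfree_monom J :: ('a \<Rightarrow>\<^sub>0 nat) \<Rightarrow>\<^sub>0 'l::field) \<in> symbolic_power E indep r}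
     \<and> gen_hamming_weight E indep r =
       Min {card U | U. U \<subseteq> E \<and> card U - rk indep U \<ge> r}
     \<and> gen_hamming_weight E indep r =
       n - Max {card F | F. flat E (dual_indep E indep) F \<and>
         rk (dual_indep E indep) F = n - k - r}"
proof -
  interpret matroid E indep by fact
  have r: "r \<le> card E - rk indep E" using assms by simp
  \<comment> \<open>Since both sets of cardinalities agree, the formula for monomials follows from
    the one for nullity at least \<open>r\<close>.\<close>
  have "{card J | J. J \<subseteq> E \<and>
      (sqfree_monom J :: ('a \<Rightarrow>\<^sub>0 nat) \<Rightarrow>\<^sub>0 'l) \<in> symbolic_power E indep r} =
    {card U | U. U \<subseteq> E \<and> card U - rk indep U \<ge> r}"
    using sqfree_monom_in_symbolic_power_iff by blast
  then show ?thesis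
    using gen_hamming_weight_eq_Min_ge[OF r] gen_hamming_weight_eq_flat[OF r] assms(2,3) by simp
qed

end
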